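(* Let $n\ge 1$, let $C_n^{(0)}=\{\sigma\in S_n : |\mathbf{PSB}^{-1}(\sigma)|=0\}$ and $c_n^{(0)}=|C_n^{(0)}|$. Then $$C_n^{(0)}=\{\sigma=\sigma_1\cdots\sigma_n\in S_n : \sigma_n\neq n\}\quad\text{and}\quad c_n^{(0)}=(n-1)\,(n-1)!.$$
   Context: $S_n$ is the set of permutations of $\{1,\dots,n\}$ in one-line notation. For $\sigma\in S_n$, $\mathbf{PSB}^{-1}(\sigma)=\{\pi\in S_n : \mathbf{PSB}(\pi)=\sigma\}$. The map $\mathbf{PSB}$: given an input permutation $\pi=\pi_1\cdots\pi_n$, a pop stack $S$ (initially empty) is used. For $i=1,\dots,n$ in order: (1) if $S$ is empty or $\pi_i=\mathrm{TOP}(S)-1$, where $\mathrm{TOP}(S)$ is the current top element of $S$, push $\pi_i$ on top of $S$; (2) else if $\pi_i<\mathrm{TOP}(S)-1$, bypass: append $\pi_i$ directly to the right end of the output; (3) else pop, i.e. remove all elements of $S$, appending them to the output from top to bottom, and then push $\pi_i$ into $S$. After the last entry has been processed, pop $S$ once more. The resulting output is the permutation $\mathbf{PSB}(\pi)$. *)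

theory Defs
  imports "HOL-Combinatorics.Multiset_Permutations"
begin

text \<open>A permutation in one-line notation is the list of its values, so the paper's
  $\pi_i$ is the list element with index $i - 1$.\<close>

definition perms :: "nat \<Rightarrow> nat list set" where
  "perms n = permutations_of_set {1..n}"

text \<open>The first argument is the current pop stack, with its top at the head of the list, the
  second one the remaining input. The result is the output produced from this state on.
  The conditions comparing $x$ with $t - 1$ are written with $x + 1$ to avoid truncated
  subtraction.\<close>

fun psb_run :: "nat list \<Rightarrow> nat list \<Rightarrow> nat list" where
  "psb_run S [] = S"
| "psb_run [] (x # xs) = psb_run [x] xs"
| "psb_run (t # S) (x # xs) =
    (if x + 1 = t then psb_run (x # t # S) xs
     else if x + 1 < t then x # psb_run (t # S) xs
     else (t # S) @ psb_run [x] xs)"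

definition PSB :: "nat list \<Rightarrow> nat list" where
  "PSB \<pi> = psb_run [] \<pi>"

definition PSB_preimage :: "nat \<Rightarrow> nat list \<Rightarrow> nat list set" where
  "PSB_preimage n \<sigma> = {\<pi> \<in> perms n. PSB \<pi> = \<sigma>}"

definition C :: "nat \<Rightarrow> nat \<Rightarrow> nat list set" where
  "C k n = {\<sigma> \<in> perms n. card (PSB_preimage n \<sigma>) = k}"

definition c :: "nat \<Rightarrow> nat \<Rightarrow> nat" where
  "c k n = card (C k n)"

end

theory Submission
  imports Defs
begin

text \<open>When the maximum \<open>n\<close> is read, the stack is popped. Afterwards the stack is always an
  interval \<open>t, \<dots>, n\<close> and every remaining entry is smaller than \<open>t\<close>, so no further entry can pop it:
  \<open>n\<close> comes out last. Conversely, let \<open>\<sigma> = A p B n\<close> with \<open>n\<close> the maximum of \<open>\<sigma>\<close> and \<open>p\<close> the maximum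
  of the rest. If \<open>\<rho>\<close> is a preimage of \<open>A p\<close>, then \<open>\<rho> n B\<close> is a preimage of \<open>\<sigma>\<close>: reading
  \<open>n\<close> completes the output \<open>A p\<close>, and \<open>B\<close> bypasses the stack because all its entries are
  smaller than \<open>p \<le> n - 1\<close>.\<close>

lemma mset_psb_run: "mset (psb_run S xs) = mset S + mset xs"
  by (induction S xs rule: psb_run.induct) auto

text \<open>An entry above everything read so far can be neither pushed onto a nonempty stack nor
  bypass it, so it pops the stack. This empties the stack exactly as the end of the input would, and
  the run restarts from \<open>[y]\<close>.\<close>

lemma psb_run_append_greater:
  assumes "\<forall>x\<in>set S \<union> set xs. x < y"
  shows "psb_run S (xs @ y # ys) = psb_run S xs @ psb_run [y] ys"
  using assms
proof (induction S xs rule: psb_run.induct)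
  case (1 S)
  then show ?case by (cases S) auto
qed auto

lemma psb_run_bypass:
  assumes "\<forall>x\<in>set xs. x + 1 < t"
  shows "psb_run (t # S) xs = xs @ t # S"
  using assms by (induction xs) auto

lemma last_psb_run_interval:
  assumes "t \<le> n" "distinct xs" "set xs \<subseteq> {..<t}"
  shows "last (psb_run [t..<Suc n] xs) = n"
  using assms
proof (induction xs arbitrary: t)
  case Nil
  then show ?case by simp
next
  case (Cons x xs)
  have stack: "[t..<Suc n] = t # [Suc t..<Suc n]"
    using Cons.prems by (simp add: upt_conv_Cons)
  show ?case
  proof (cases "x + 1 = t")
    case True
    then have "psb_run [t..<Suc n] (x # xs) = psb_run [x..<Suc n] xs"
      using stack Cons.prems by (simp add: upt_conv_Cons)
    \<comment> \<open>Distinctness excludes \<open>x\<close> itself, so the bound on the remaining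
      entries drops from \<open>t = x + 1\<close> to the new top \<open>x\<close>.\<close>
    moreover have "set xs \<subseteq> {..<x}"
      using Cons.prems True by (auto simp: less_Suc_eq)
    ultimately show ?thesis
      using Cons.IH[of x] Cons.prems True by simp
  next
    case False
    then have "psb_run [t..<Suc n] (x # xs) = x # psb_run [t..<Suc n] xs"
      using stack Cons.prems by simp
    moreover have "psb_run [t..<Suc n] xs \<noteq> []"
      using mset_psb_run[of "[t..<Suc n]" xs] stack by auto
    ultimately show ?thesis
      using Cons.IH[of t] Cons.prems by simp
  qed
qed

lemma last_PSB:
  assumes "distinct \<pi>" "n \<in> set \<pi>" "\<forall>x\<in>set \<pi>. x \<le> n"
  shows "last (PSB \<pi>) = n"
proof -
  obtain A B where \<pi>: "\<pi> = A @ n # B"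
    using assms(2) by (meson split_list)
  have less: "\<forall>x\<in>set A. x < n" "\<forall>x\<in>set B. x < n"
    using assms \<pi> by (auto simp: le_less)
  \<comment> \<open>The singleton stack \<open>[n]\<close> is written as an interval to start the
    invariant at \<open>t = n\<close>.\<close>
  have "PSB \<pi> = psb_run [] A @ psb_run [n..<Suc n] B"
    using less(1) by (simp add: PSB_def \<pi> psb_run_append_greater)
  moreover have "psb_run [n..<Suc n] B \<noteq> []"
    using mset_psb_run[of "[n]" B] by auto
  moreover have "last (psb_run [n..<Suc n] B) = n"
    using less(2) assms(1) \<pi> by (intro last_psb_run_interval) auto
  ultimately show ?thesis
    by simp
qed

text \<open>Arbitrary distinct lists and any \<open>m\<close> above them are allowed because the
  recursion passes to \<open>A\<close> with new last entry \<open>p\<close>, and the values in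
  \<open>A @ [p]\<close> need not form an initial segment.\<close>

lemma PSB_surj_max_last:
  assumes "distinct \<tau>" "\<forall>x\<in>set \<tau>. x < m"
  shows "\<exists>\<pi>. PSB \<pi> = \<tau> @ [m]"
  using assms
proof (induction \<tau> arbitrary: m rule: length_induct)
  case (1 \<tau>)
  show ?case
  proof (cases "\<tau> = []")
    case True
    then have "PSB [m] = \<tau> @ [m]"
      by (simp add: PSB_def)
    then show ?thesis by blast
  next
    case False
    define p where "p = Max (set \<tau>)"
    have p: "p \<in> set \<tau>" "\<forall>x\<in>set \<tau>. x \<le> p"
      using False by (auto simp: p_def)
    then obtain A B where \<tau>: "\<tau> = A @ p # B"
      by (meson split_list)
    have less: "\<forall>x\<in>set A. x < p" "\<forall>x\<in>set B. x < p"
      using p(2) 1(2) \<tau> by (auto simp: le_less)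
    have "p < m"
      using 1(3) p(1) by blast
    obtain \<rho> where \<rho>: "PSB \<rho> = A @ [p]"
      using 1(1)[rule_format, of A p] 1(2) \<tau> less(1) by auto
    \<comment> \<open>A preimage has the same entries as its image, so \<open>\<rho>\<close> lies
      below \<open>m\<close> and the run splits at \<open>m\<close>.\<close>
    have "mset \<rho> = mset (A @ [p])"
      using mset_psb_run[of "[]" \<rho>] \<rho> by (simp add: PSB_def)
    then have "set \<rho> = set (A @ [p])"
      by (rule mset_eq_setD)
    then have "\<forall>x\<in>set \<rho>. x < m"
      using less(1) \<open>p < m\<close> by auto
    then have "PSB (\<rho> @ m # B) = A @ p # psb_run [m] B"
      using \<rho> by (simp add: PSB_def psb_run_append_greater)
    also have "psb_run [m] B = B @ [m]"
      using less(2) \<open>p < m\<close> by (intro psb_run_bypass) fastforce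
    finally have "PSB (\<rho> @ m # B) = \<tau> @ [m]"
      by (simp add: \<tau>)
    then show ?thesis by blast
  qed
qed

lemma perms_PSB_iff: "PSB \<pi> \<in> perms n \<longleftrightarrow> \<pi> \<in> perms n"
proof -
  have "mset (PSB \<pi>) = mset \<pi>"
    by (simp add: PSB_def mset_psb_run)
  then have "set (PSB \<pi>) = set \<pi>" "distinct (PSB \<pi>) = distinct \<pi>"
    by (rule mset_eq_setD, rule mset_eq_imp_distinct_iff)
  then show ?thesis
    by (simp add: perms_def permutations_of_set_def)
qed

text \<open>Deleting the final \<open>n\<close> identifies these permutations with
  \<open>perms (n - 1)\<close>; this supplies the prefix for the surjectivity argument and later the
  count.\<close>

lemma perms_last_iff:
  assumes "n \<ge> 1"
  shows "\<sigma> \<in> perms n \<and> last \<sigma> = n \<longleftrightarrow> (\<exists>\<tau>\<in>perms (n - 1). \<sigma> = \<tau> @ [n])"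
proof (cases \<sigma> rule: rev_cases)
  case Nil
  then show ?thesis
    using assms by (simp add: perms_def permutations_of_set_def)
next
  case (snoc \<tau> y)
  have "insert n (set \<tau>) = {1..n} \<longleftrightarrow> set \<tau> = {1..n - 1}" if "n \<notin> set \<tau>"
  proof -
    have "{1..n} = insert n {1..n - 1}" "n \<notin> {1..n - 1}"
      using assms by auto
    then show ?thesis
      using insert_ident[OF that, of "{1..n - 1}"] by simp
  qed
  moreover have "n \<notin> set \<tau>" if "set \<tau> = {1..n - 1}"
    using that assms by simp
  ultimately show ?thesis
    unfolding snoc perms_def permutations_of_set_def by auto
qed

lemma PSB_preimage_nonempty_iff:
  assumes "n \<ge> 1" "\<sigma> \<in> perms n"
  shows "PSB_preimage n \<sigma> \<noteq> {} \<longleftrightarrow> last \<sigma> = n"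
proof
  assume "PSB_preimage n \<sigma> \<noteq> {}"
  then obtain \<pi> where \<pi>: "\<pi> \<in> perms n" "PSB \<pi> = \<sigma>"
    unfolding PSB_preimage_def by blast
  then have "distinct \<pi>" "set \<pi> = {1..n}"
    by (simp_all add: perms_def permutations_of_set_def)
  then have "last (PSB \<pi>) = n"
    using assms(1) by (intro last_PSB) simp_all
  then show "last \<sigma> = n"
    by (simp only: \<pi>(2))
next
  assume "last \<sigma> = n"
  then obtain \<tau> where \<tau>: "\<tau> \<in> perms (n - 1)" "\<sigma> = \<tau> @ [n]"
    using perms_last_iff[OF assms(1), of \<sigma>] assms(2) by blast
  then have "distinct \<tau>" "\<forall>x\<in>set \<tau>. x < n"
    using assms(1) by (auto simp: perms_def permutations_of_set_def)
  then obtain \<pi> where "PSB \<pi> = \<sigma>"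
    using PSB_surj_max_last \<tau>(2) by blast
  then show "PSB_preimage n \<sigma> \<noteq> {}"
    using assms(2) perms_PSB_iff[of \<pi> n] unfolding PSB_preimage_def by blast
qed

theorem proposition3p1:
  fixes n :: nat
  assumes "n \<ge> 1"
  shows "C 0 n = {\<sigma> \<in> perms n. \<sigma> ! (n - 1) \<noteq> n} \<and> c 0 n = (n - 1) * fact (n - 1)"
proof
  have finite: "finite (perms k)" and card: "card (perms k) = fact k" for k
    by (simp_all add: perms_def)
  have nth: "\<sigma> ! (n - 1) = last \<sigma>" if "\<sigma> \<in> perms n" for \<sigma>
  proof -
    have "length \<sigma> = n"
      using that by (auto simp: perms_def dest: length_finite_permutations_of_set)
    then show ?thesis
      using assms last_conv_nth[of \<sigma>] by force
  qed
  \<comment> \<open>Finiteness is essential: \<open>card\<close> is also 0 on infinite sets, so only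
    for finite sets does it detect emptiness.\<close>
  have "finite (PSB_preimage n \<sigma>)" for \<sigma>
    using finite by (simp add: PSB_preimage_def)
  then have "C 0 n = {\<sigma> \<in> perms n. PSB_preimage n \<sigma> = {}}"
    by (simp add: C_def)
  also have "\<dots> = {\<sigma> \<in> perms n. \<sigma> ! (n - 1) \<noteq> n}"
    by (rule Collect_cong) (metis PSB_preimage_nonempty_iff assms nth)
  finally show C: "C 0 n = {\<sigma> \<in> perms n. \<sigma> ! (n - 1) \<noteq> n}" .
  have "{\<sigma> \<in> perms n. \<sigma> ! (n - 1) = n} = {\<sigma>. \<sigma> \<in> perms n \<and> last \<sigma> = n}"
    using nth by auto
  also have "\<dots> = (\<lambda>\<tau>. \<tau> @ [n]) ` perms (n - 1)"
    unfolding perms_last_iff[OF assms] by auto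
  finally have "card {\<sigma> \<in> perms n. \<sigma> ! (n - 1) = n} = fact (n - 1)"
    by (simp add: card_image inj_on_def card)
  moreover have "C 0 n = perms n - {\<sigma> \<in> perms n. \<sigma> ! (n - 1) = n}"
    using C by auto
  ultimately have "c 0 n = fact n - fact (n - 1)"
    using finite by (simp add: c_def card card_Diff_subset)
  \<comment> \<open>Since \<open>n \<ge> 1\<close>, \<open>fact n = n * fact (n - 1)\<close>, and
    the common factor comes out of the difference.\<close>
  then show "c 0 n = (n - 1) * fact (n - 1)"
    using assms by (simp add: fact_reduce diff_mult_distrib)
qed

end
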